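(* There are absolute constants $K_*\geq 1$ and $A>0$ such that for every $K\ge K_*$ there is $\varepsilon_*=\varepsilon_*(K)>0$ such that for every $0<\varepsilon\le\varepsilon_*$ the following holds. Let $(a,b,c,d,\tilde a):[0,+\infty)\to\mathbb{R}^5$ be the solution of the ODE system \begin{align*} \partial_ta&=-\varepsilon^{-2}cd-\varepsilon ab-\varepsilon^2\exp(-K^{10})ac,\\ \partial_tb&=\varepsilon a^2-\varepsilon^{-1}K^{10}c^2,\\ \partial_tc&=\varepsilon^2\exp(-K^{10})a^2+\varepsilon^{-1}K^{10}bc,\\ \partial_td&=\varepsilon^{-2}ca-Kd\tilde a,\\ \partial_t\tilde a&=Kd^2, \end{align*} with initial data $a(0)=1$, $b(0)=c(0)=d(0)=\tilde a(0)=0$. Then there exists a time $t_c$ with $|t_c-\sqrt2|\le A/\sqrt K$ such that $$|a(t)-1|\le AK^{-10}\quad\text{and}\quad|b(t)|,|c(t)|,|d(t)|,|\tilde a(t)|\le AK^{-10}\qquad\text{for }0\le t\le t_c-1/\sqrt K,$$ and $$|\tilde a(t)-1|\le AK^{-10}\quad\text{and}\quad|a(t)|,|b(t)|,|c(t)|,|d(t)|\le AK^{-10}\qquad\text{for }t\ge t_c+1/\sqrt K.$$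
   Context: The system is globally well posed, since it preserves $a^2+b^2+c^2+d^2+\tilde a^2$. The constant $A$ makes explicit the absolute implied constants in the $O(\cdot)$ notation. *)

theory Defs
  imports Complex_Main
begin

text \<open>
  Solutions on $[0,\infty)$: only the values at times \<open>t \<ge> 0\<close> matter, and the derivative at \<open>0\<close>
  is one-sided. The fifth component \<open>a'\<close> stands for $\tilde a$.
\<close>

definition solves_ode ::
  "real \<Rightarrow> real \<Rightarrow> (real \<Rightarrow> real) \<Rightarrow> (real \<Rightarrow> real) \<Rightarrow> (real \<Rightarrow> real) \<Rightarrow> (real \<Rightarrow> real) \<Rightarrow> (real \<Rightarrow> real) \<Rightarrow> bool"
  where
  "solves_ode K \<epsilon> a b c d a' \<longleftrightarrow>
    (\<forall>t\<ge>0.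
      (a has_real_derivative
         (- (1 / \<epsilon>^2) * c t * d t - \<epsilon> * a t * b t - \<epsilon>^2 * exp (- (K^10)) * a t * c t))
         (at t within {0..}) \<and>
      (b has_real_derivative
         (\<epsilon> * (a t)^2 - (1 / \<epsilon>) * K^10 * (c t)^2))
         (at t within {0..}) \<and>
      (c has_real_derivative
         (\<epsilon>^2 * exp (- (K^10)) * (a t)^2 + (1 / \<epsilon>) * K^10 * b t * c t))
         (at t within {0..}) \<and>
      (d has_real_derivative
         ((1 / \<epsilon>^2) * c t * a t - K * d t * a' t))
         (at t within {0..}) \<and>
      (a' has_real_derivative
         (K * (d t)^2))
         (at t within {0..}))"

end

theory Submission
  imports Defs "HOL-Analysis.Henstock_Kurzweil_Integration" "HOL-Real_Asymp.Real_Asymp"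
begin

text \<open>
  Write \<open>\<omega> = c / \<epsilon>^2\<close> for the rotation speed of \<open>(a, d)\<close> and \<open>M = K^10\<close>. Up to time \<open>2\<close> the
  feedback of \<open>c\<close> on \<open>b\<close> is negligible for small \<open>\<epsilon>\<close>, so that \<open>b \<approx> \<epsilon> t\<close> and
  \<open>\<omega> \<approx> exp (M (t^2 / 2 - 1))\<close> as long as \<open>a \<approx> 1\<close>. Hence \<open>\<omega>\<close> is tiny before \<open>sqrt 2 - 1 / sqrt K\<close>
  and nothing has moved, while from \<open>sqrt 2 + 1 / (2 sqrt K)\<close> on it is huge; one may thus take
  \<open>t\<^sub>c = sqrt 2\<close>. Fast rotation equidistributes the energy between \<open>a\<close> and \<open>d\<close>, so \<open>1 - a'\<close> decays
  like \<open>exp (- K t / 2)\<close> and is below \<open>K^(-20) / 2\<close> at time \<open>sqrt 2 + 1 / sqrt K\<close>. Since \<open>a'\<close> is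
  monotone and the energy is conserved, this persists for all later times.
\<close>

lemma derivative_ge_imp_increment_ge:
  fixes f f' :: "real \<Rightarrow> real"
  assumes "s \<le> u"
    and "\<And>t. s \<le> t \<Longrightarrow> t \<le> u \<Longrightarrow> (f has_real_derivative f' t) (at t within {s..u})"
    and "\<And>t. s \<le> t \<Longrightarrow> t \<le> u \<Longrightarrow> m \<le> f' t"
  shows "f s + m * (u - s) \<le> f u"
proof -
  have "\<exists>x\<in>{s..u}. f u - f s = f' x * (u - s)"
    using assms(1,2) by (intro mvt_very_simple) (auto simp: has_field_derivative_def)
  then obtain x where "x \<in> {s..u}" "f u - f s = f' x * (u - s)" by blast
  moreover from this have "m * (u - s) \<le> f' x * (u - s)"
    using assms(1,3) by (intro mult_right_mono) auto
  ultimately show ?thesis by linarith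
qed

lemma derivative_le_imp_increment_le:
  fixes f f' :: "real \<Rightarrow> real"
  assumes "s \<le> u"
    and "\<And>t. s \<le> t \<Longrightarrow> t \<le> u \<Longrightarrow> (f has_real_derivative f' t) (at t within {s..u})"
    and "\<And>t. s \<le> t \<Longrightarrow> t \<le> u \<Longrightarrow> f' t \<le> m"
  shows "f u \<le> f s + m * (u - s)"
proof -
  have "- f s + - m * (u - s) \<le> - f u"
    by (rule derivative_ge_imp_increment_ge[where f' = "\<lambda>t. - f' t"])
      (use assms in \<open>auto intro: DERIV_minus\<close>)
  then show ?thesis by simp
qed

lemma derivative_nonneg_imp_le:
  fixes f f' :: "real \<Rightarrow> real"
  assumes "s \<le> u"
    and "\<And>t. s \<le> t \<Longrightarrow> t \<le> u \<Longrightarrow> (f has_real_derivative f' t) (at t within {s..u})"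
    and "\<And>t. s \<le> t \<Longrightarrow> t \<le> u \<Longrightarrow> 0 \<le> f' t"
  shows "f s \<le> f u"
  using derivative_ge_imp_increment_ge[OF assms] by simp

text \<open>Here \<open>M\<close>, \<open>r\<close> and \<open>z\<close> stand for \<open>K^10\<close>, \<open>1 / sqrt K\<close> and \<open>a'\<close>.\<close>

locale circuit =
  fixes K M r \<epsilon> :: real and a b c d z :: "real \<Rightarrow> real"
  assumes deriv_a: "t \<ge> 0 \<Longrightarrow> (a has_real_derivative
         (- (1 / \<epsilon>^2) * c t * d t - \<epsilon> * a t * b t - \<epsilon>^2 * exp (- M) * a t * c t)) (at t within {0..})"
    and deriv_b: "t \<ge> 0 \<Longrightarrow> (b has_real_derivative
         (\<epsilon> * (a t)^2 - (1 / \<epsilon>) * M * (c t)^2)) (at t within {0..})"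
    and deriv_c: "t \<ge> 0 \<Longrightarrow> (c has_real_derivative
         (\<epsilon>^2 * exp (- M) * (a t)^2 + (1 / \<epsilon>) * M * b t * c t)) (at t within {0..})"
    and deriv_d: "t \<ge> 0 \<Longrightarrow> (d has_real_derivative
         ((1 / \<epsilon>^2) * c t * a t - K * d t * z t)) (at t within {0..})"
    and deriv_z: "t \<ge> 0 \<Longrightarrow> (z has_real_derivative (K * (d t)^2)) (at t within {0..})"
    and init: "a 0 = 1" "b 0 = 0" "c 0 = 0" "d 0 = 0" "z 0 = 0"
    and K_ge: "1 \<le> K"
    and M_ge: "1 \<le> M"
    and r_pos: "0 < r"
    and r_le: "r \<le> 1/5"
    and kappa_small: "27 * M * exp (- (M * r)) \<le> 1"
    and eps_pos: "0 < \<epsilon>"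
    and eps_le: "\<epsilon> \<le> exp (- 2 * M)"
begin

definition \<kappa> where "\<kappa> = exp (- (M * r))"

lemma kappa_pos: "0 < \<kappa>" by (simp add: \<kappa>_def)

lemma M_kappa: "27 * (M * \<kappa>) \<le> 1" using kappa_small by (simp add: \<kappa>_def)

lemma kappa_le: "\<kappa> \<le> 1/27"
proof -
  have "1 * \<kappa> \<le> M * \<kappa>" using M_ge kappa_pos by (intro mult_right_mono) auto
  then show ?thesis using M_kappa by linarith
qed

lemma delta_le_kappa: "exp (- M) \<le> \<kappa>"
proof -
  have "M * r \<le> M * 1" using M_ge r_le by (intro mult_left_mono) auto
  then show ?thesis by (simp add: \<kappa>_def)
qed

lemma M_delta: "27 * (M * exp (- M)) \<le> 1"
proof -
  have "M * exp (- M) \<le> M * \<kappa>" using M_ge delta_le_kappa by (intro mult_left_mono) auto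
  then show ?thesis using M_kappa by linarith
qed

lemma delta_le: "exp (- M) \<le> 1/27"
  using delta_le_kappa kappa_le by linarith

lemma eps_le_delta: "27 * \<epsilon> \<le> exp (- M)"
proof -
  have "\<epsilon> \<le> exp (- M) * exp (- M)" using eps_le by (simp flip: exp_add)
  also have "\<dots> \<le> exp (- M) * (1/27)" using delta_le by (intro mult_left_mono) auto
  finally show ?thesis by simp
qed

lemma M_eps_nonneg: "0 \<le> M / \<epsilon>"
  using M_ge eps_pos by simp

lemma has_deriv_subset:
  assumes "(f has_real_derivative D) (at t within {0..})" "0 \<le> s"
  shows "(f has_real_derivative D) (at t within {s..u})"
  using assms by (elim has_field_derivative_subset) auto

lemmas deriv_within =
  deriv_a[THEN has_deriv_subset] deriv_b[THEN has_deriv_subset] deriv_c[THEN has_deriv_subset]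
  deriv_d[THEN has_deriv_subset] deriv_z[THEN has_deriv_subset]

lemma energy:
  assumes "t \<ge> 0"
  shows "(a t)^2 + (b t)^2 + (c t)^2 + (d t)^2 + (z t)^2 = 1"
proof -
  define f where "f t = (a t)^2 + (b t)^2 + (c t)^2 + (d t)^2 + (z t)^2" for t
  have D: "(f has_real_derivative 0) (at s within {0..t})" if "0 \<le> s" "s \<le> t" for s
    unfolding f_def using eps_pos that
    by (auto intro!: derivative_eq_intros deriv_within simp: field_simps power2_eq_square)
  have "f 0 \<le> f t" "f t \<le> f 0 + 0 * (t - 0)"
    using derivative_nonneg_imp_le[OF assms D] derivative_le_imp_increment_le[OF assms D, of 0] by auto
  then show ?thesis by (simp add: f_def init)
qed

lemma abs_le_1:
  assumes "t \<ge> 0"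
  shows "\<bar>a t\<bar> \<le> 1" "\<bar>b t\<bar> \<le> 1" "\<bar>c t\<bar> \<le> 1" "\<bar>d t\<bar> \<le> 1" "\<bar>z t\<bar> \<le> 1"
  unfolding abs_square_le_1[symmetric] using energy[OF assms]
  by (smt (verit) zero_le_power2)+

lemma a_sq_le: "t \<ge> 0 \<Longrightarrow> (a t)^2 \<le> 1"
  using abs_le_1(1) abs_square_le_1 by blast

lemma z_mono:
  assumes "0 \<le> s" "s \<le> t"
  shows "z s \<le> z t"
  using assms K_ge
  by (intro derivative_nonneg_imp_le[OF _ deriv_z[THEN has_deriv_subset]]) auto

lemma z_nonneg: "0 \<le> t \<Longrightarrow> 0 \<le> z t"
  using z_mono[of 0 t] init by simp

lemma c_nonneg:
  assumes "t \<ge> 0"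
  shows "0 \<le> c t"
proof -
  have "continuous_on {0..t} b"
    by (rule DERIV_continuous_on[OF deriv_b[THEN has_deriv_subset]]) auto
  then obtain B where B: "\<And>s. s \<in> {0..t} \<Longrightarrow> (B has_vector_derivative b s) (at s within {0..t})"
    using antiderivative_continuous by blast
  have B': "(B has_real_derivative b s) (at s within {0..t})" if "0 \<le> s" "s \<le> t" for s
    using B[of s] that by (simp add: has_real_derivative_iff_has_vector_derivative)
  define p where "p s = exp (- (M / \<epsilon>) * B s)" for s
  have "c 0 * p 0 \<le> c t * p t"
  proof (rule derivative_nonneg_imp_le[OF assms])
    fix s assume s: "0 \<le> s" "s \<le> t"
    show "((\<lambda>s. c s * p s) has_real_derivative (\<epsilon>^2 * exp (- M) * (a s)^2 * p s)) (at s within {0..t})"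
      unfolding p_def using eps_pos
      by (auto intro!: derivative_eq_intros deriv_within B' s simp: field_simps)
    show "0 \<le> \<epsilon>^2 * exp (- M) * (a s)^2 * p s"
      by (simp add: p_def)
  qed
  then show ?thesis by (simp add: init p_def zero_le_mult_iff)
qed

lemma b_upper:
  assumes "t \<ge> 0"
  shows "b t \<le> \<epsilon> * t"
proof -
  have "b t \<le> b 0 + \<epsilon> * (t - 0)"
  proof (rule derivative_le_imp_increment_le[OF assms deriv_b[THEN has_deriv_subset]])
    fix s :: real assume s: "0 \<le> s" "s \<le> t"
    have "\<epsilon> * (a s)^2 \<le> \<epsilon> * 1" using a_sq_le[of s] s eps_pos by (intro mult_left_mono) auto
    moreover have "0 \<le> (1 / \<epsilon>) * M * (c s)^2" using eps_pos M_ge by simp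
    ultimately show "\<epsilon> * (a s)^2 - (1 / \<epsilon>) * M * (c s)^2 \<le> \<epsilon>" by linarith
  qed auto
  then show ?thesis by (simp add: init)
qed

lemma c_upper:
  assumes "t \<ge> 0"
  shows "c t \<le> \<epsilon>^2 * t * exp (M * (t^2 / 2 - 1))"
proof -
  have "c t * exp (- (M * t^2 / 2)) \<le> c 0 * exp (- (M * 0^2 / 2)) + (\<epsilon>^2 * exp (- M)) * (t - 0)"
  proof (rule derivative_le_imp_increment_le[OF assms])
    fix s assume s: "0 \<le> s" "s \<le> t"
    show "((\<lambda>s. c s * exp (- (M * s^2 / 2))) has_real_derivative
       exp (- (M * s^2 / 2)) * (\<epsilon>^2 * exp (- M) * (a s)^2 + M / \<epsilon> * ((b s - \<epsilon> * s) * c s))) (at s within {0..t})"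
      using eps_pos
      by (auto intro!: derivative_eq_intros deriv_within s simp: field_simps)
    have "(\<epsilon>^2 * exp (- M)) * (a s)^2 \<le> (\<epsilon>^2 * exp (- M)) * 1"
      using a_sq_le[of s] s by (intro mult_left_mono) auto
    moreover have "(b s - \<epsilon> * s) * c s \<le> 0"
      using b_upper[of s] c_nonneg[of s] s by (intro mult_nonpos_nonneg) auto
    then have "M / \<epsilon> * ((b s - \<epsilon> * s) * c s) \<le> 0"
      by (rule mult_nonneg_nonpos[OF M_eps_nonneg])
    ultimately have "\<epsilon>^2 * exp (- M) * (a s)^2 + M / \<epsilon> * ((b s - \<epsilon> * s) * c s) \<le> \<epsilon>^2 * exp (- M)"
      by linarith
    then have "exp (- (M * s^2 / 2)) * (\<epsilon>^2 * exp (- M) * (a s)^2 + M / \<epsilon> * ((b s - \<epsilon> * s) * c s))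
      \<le> exp (- (M * s^2 / 2)) * (\<epsilon>^2 * exp (- M))" by (intro mult_left_mono) auto
    also have "\<dots> \<le> 1 * (\<epsilon>^2 * exp (- M))"
      using M_ge by (intro mult_right_mono) auto
    finally show "exp (- (M * s^2 / 2)) * (\<epsilon>^2 * exp (- M) * (a s)^2 + M / \<epsilon> * ((b s - \<epsilon> * s) * c s))
      \<le> \<epsilon>^2 * exp (- M)" by simp
  qed
  then have *: "c t * exp (- (M * t^2 / 2)) \<le> \<epsilon>^2 * exp (- M) * t" by (simp add: init)
  have "c t = c t * exp (- (M * t^2 / 2)) * exp (M * t^2 / 2)"
    by (simp add: mult.assoc flip: exp_add)
  also have "\<dots> \<le> \<epsilon>^2 * exp (- M) * t * exp (M * t^2 / 2)"
    using * by (intro mult_right_mono) auto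
  also have "\<dots> = \<epsilon>^2 * t * (exp (- M) * exp (M * t^2 / 2))" by simp
  also have "exp (- M) * exp (M * t^2 / 2) = exp (M * (t^2 / 2 - 1))"
    by (simp add: algebra_simps flip: exp_add)
  finally show ?thesis .
qed

text \<open>The upper bound on \<^term>\<open>\<epsilon>\<close> makes the feedback of \<^term>\<open>c\<close> on \<^term>\<open>b\<close> negligible up to time \<open>2\<close>.\<close>

lemma c_le_eps:
  assumes "0 \<le> t" "t \<le> 2"
  shows "c t \<le> 2 * \<epsilon>^2 * exp M" "c t \<le> \<epsilon>"
proof -
  have "t^2 \<le> 2^2" using assms by (intro power_mono) auto
  then have "M * (t^2 / 2 - 1) \<le> M * 1" using M_ge by (intro mult_left_mono) auto
  then have e: "exp (M * (t^2 / 2 - 1)) \<le> exp M" by simp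
  have "c t \<le> \<epsilon>^2 * t * exp (M * (t^2 / 2 - 1))" using c_upper assms by simp
  also have "\<dots> \<le> \<epsilon>^2 * 2 * exp M"
    using assms e by (intro mult_mono) auto
  finally show 1: "c t \<le> 2 * \<epsilon>^2 * exp M" by simp
  have "\<epsilon> * exp M \<le> exp (- 2 * M) * exp M" using eps_le by (intro mult_right_mono) auto
  also have "\<dots> = exp (- M)" by (simp flip: exp_add)
  finally have "\<epsilon> * exp M \<le> 1/27" using delta_le by linarith
  then have "2 * \<epsilon> * (\<epsilon> * exp M) \<le> 2 * \<epsilon> * (1/27)" using eps_pos by (intro mult_left_mono) auto
  moreover have "2 * \<epsilon>^2 * exp M = 2 * \<epsilon> * (\<epsilon> * exp M)" by (simp add: power2_eq_square)
  ultimately show "c t \<le> \<epsilon>" using 1 eps_pos by linarith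
qed

lemma deriv_b_lower:
  assumes "0 \<le> t" "t \<le> 2"
  shows "\<epsilon> * ((a t)^2 - exp (- M)) \<le> \<epsilon> * (a t)^2 - (1 / \<epsilon>) * M * (c t)^2"
proof -
  have "(c t)^2 \<le> (2 * \<epsilon>^2 * exp M)^2"
    using c_le_eps[OF assms] c_nonneg assms by (intro power_mono) auto
  then have "(1 / \<epsilon>) * M * (c t)^2 \<le> (1 / \<epsilon>) * M * (2 * \<epsilon>^2 * exp M)^2"
    using eps_pos M_ge by (intro mult_left_mono) auto
  also have "\<dots> = 4 * \<epsilon> * M * (\<epsilon> * exp M)^2" using eps_pos by (simp add: field_simps power2_eq_square)
  also have "\<dots> \<le> 4 * \<epsilon> * M * (exp (- M))^2"
  proof -
    have "\<epsilon> * exp M \<le> exp (- 2 * M) * exp M" using eps_le by (intro mult_right_mono) auto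
    also have "\<dots> = exp (- M)" by (simp flip: exp_add)
    finally show ?thesis using eps_pos M_ge by (intro mult_left_mono power_mono) auto
  qed
  also have "\<dots> = 4 * \<epsilon> * exp (- M) * (M * exp (- M))" by (simp add: power2_eq_square)
  also have "\<dots> \<le> 4 * \<epsilon> * exp (- M) * (1/27)" using M_delta eps_pos by (intro mult_left_mono) auto
  also have "\<dots> \<le> \<epsilon> * exp (- M)" using eps_pos by simp
  finally show ?thesis by (simp add: algebra_simps)
qed

lemma b_lower_from:
  assumes "0 \<le> s" "s \<le> t" "t \<le> 2"
  shows "b s - 2 * \<epsilon> * exp (- M) \<le> b t"
proof -
  have "b s + (- \<epsilon> * exp (- M)) * (t - s) \<le> b t"
  proof (rule derivative_ge_imp_increment_ge[OF assms(2) deriv_b[THEN has_deriv_subset]])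
    fix x assume x: "s \<le> x" "x \<le> t"
    have "0 \<le> \<epsilon> * (a x)^2" using eps_pos by simp
    then show "- \<epsilon> * exp (- M) \<le> \<epsilon> * (a x)^2 - (1 / \<epsilon>) * M * (c x)^2"
      using deriv_b_lower[of x] x assms by (simp add: right_diff_distrib)
  qed (use assms in auto)
  moreover have "(\<epsilon> * exp (- M)) * (t - s) \<le> (\<epsilon> * exp (- M)) * 2"
    using assms eps_pos by (intro mult_left_mono) auto
  ultimately show ?thesis by linarith
qed

lemma abs_b_le:
  assumes "0 \<le> t" "t \<le> 2"
  shows "\<bar>b t\<bar> \<le> 2 * \<epsilon>"
proof -
  have "\<epsilon> * t \<le> \<epsilon> * 2" using assms eps_pos by (intro mult_left_mono) auto
  then have "b t \<le> 2 * \<epsilon>" using b_upper[of t] assms by simp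
  moreover have "\<epsilon> * exp (- M) \<le> \<epsilon> * 1" using M_ge eps_pos by (intro mult_left_mono) auto
  then have "- (2 * \<epsilon>) \<le> b t" using b_lower_from[of 0 t] assms by (simp add: init)
  ultimately show ?thesis by simp
qed

lemma drift_small:
  assumes "0 \<le> t" "t \<le> 2"
  shows "\<bar>\<epsilon> * a t * b t + \<epsilon>^2 * exp (- M) * a t * c t\<bar> \<le> exp (- M)"
proof -
  have e1: "\<epsilon> \<le> 1" using eps_le_delta delta_le by linarith
  have "\<bar>\<epsilon> * a t * b t\<bar> \<le> \<epsilon> * 1 * 1"
    unfolding abs_mult using assms abs_le_1 eps_pos by (intro mult_mono) auto
  moreover have "\<bar>\<epsilon>^2 * exp (- M) * a t * c t\<bar> \<le> (\<epsilon> * 1) * 1 * 1 * 1"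
    unfolding abs_mult power2_eq_square using assms abs_le_1 eps_pos M_ge e1
    by (intro mult_mono) auto
  ultimately show ?thesis using eps_le_delta eps_pos by linarith
qed

definition T1 where "T1 = sqrt 2 - r"

lemma sqrt2_bounds: "141/100 \<le> sqrt (2::real)" "sqrt (2::real) \<le> 142/100"
  by (rule real_le_rsqrt real_le_lsqrt; simp add: power2_eq_square)+

lemma T1_bounds: "1 \<le> T1" "T1 \<le> 3/2"
  using sqrt2_bounds r_pos r_le by (auto simp: T1_def)

lemma T1_sq: "T1^2 / 2 - 1 = r^2 / 2 - sqrt 2 * r"
proof -
  have "sqrt 2 * sqrt 2 = (2::real)" by simp
  then have "T1^2 = 2 - 2 * (sqrt 2 * r) + r^2" by (simp add: T1_def power2_diff)
  then show ?thesis by (simp add: field_simps)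
qed

lemma c_early:
  assumes "0 \<le> t" "t \<le> T1"
  shows "c t \<le> 2 * \<epsilon>^2 * \<kappa>"
proof -
  have "t^2 \<le> T1^2" using assms by (intro power_mono) auto
  moreover have "r^2 \<le> r * (1/5)" unfolding power2_eq_square using r_pos r_le by (intro mult_left_mono) auto
  moreover have "141/100 * r \<le> sqrt 2 * r" using sqrt2_bounds r_pos by (intro mult_right_mono) auto
  ultimately have "t^2 / 2 - 1 \<le> - r" using T1_sq r_pos by linarith
  then have "M * (t^2 / 2 - 1) \<le> M * (- r)" using M_ge by (intro mult_left_mono) auto
  then have e: "exp (M * (t^2 / 2 - 1)) \<le> \<kappa>" by (simp add: \<kappa>_def)
  have "c t \<le> \<epsilon>^2 * t * exp (M * (t^2 / 2 - 1))" using c_upper assms by simp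
  also have "\<dots> \<le> \<epsilon>^2 * 2 * \<kappa>"
    using assms e T1_bounds by (intro mult_mono) auto
  finally show ?thesis by simp
qed

lemma a_early:
  assumes "0 \<le> t" "t \<le> T1"
  shows "1 - 5 * \<kappa> \<le> a t" "a t \<le> 1" "1 - 10 * \<kappa> \<le> (a t)^2"
proof -
  have "a 0 + (- 3 * \<kappa>) * (t - 0) \<le> a t"
  proof (rule derivative_ge_imp_increment_ge[OF assms(1) deriv_a[THEN has_deriv_subset]])
    fix s assume s: "0 \<le> s" "s \<le> t"
    have "- (1 / \<epsilon>^2) * c s * d s \<ge> - 2 * \<kappa>"
    proof -
      have "(1 / \<epsilon>^2) * c s \<le> (1 / \<epsilon>^2) * (2 * \<epsilon>^2 * \<kappa>)"
        using c_early[of s] s assms by (intro mult_left_mono) auto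
      also have "\<dots> = 2 * \<kappa>" using eps_pos by simp
      finally have "(1 / \<epsilon>^2) * c s \<le> 2 * \<kappa>" .
      moreover have "((1 / \<epsilon>^2) * c s) * d s \<le> ((1 / \<epsilon>^2) * c s) * 1"
        using abs_le_1(4)[of s] c_nonneg[of s] s by (intro mult_left_mono) auto
      ultimately show ?thesis by simp
    qed
    moreover have "\<bar>\<epsilon> * a s * b s + \<epsilon>^2 * exp (- M) * a s * c s\<bar> \<le> exp (- M)"
      using drift_small[of s] s assms T1_bounds by simp
    ultimately show "- 3 * \<kappa> \<le> - (1 / \<epsilon>^2) * c s * d s - \<epsilon> * a s * b s - \<epsilon>^2 * exp (- M) * a s * c s"
      using delta_le_kappa by linarith
  qed auto
  then have "1 - 3 * \<kappa> * t \<le> a t" by (simp add: init)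
  moreover have "(3 * \<kappa>) * t \<le> (3 * \<kappa>) * (3/2)"
    using assms kappa_pos T1_bounds by (intro mult_left_mono) auto
  ultimately show 1: "1 - 5 * \<kappa> \<le> a t" using kappa_pos by linarith
  show 2: "a t \<le> 1" using abs_le_1(1)[of t] assms by simp
  have "(1 - a t) * (1 + a t) \<le> (5 * \<kappa>) * 2"
    using 1 2 kappa_pos kappa_le by (intro mult_mono) auto
  then show "1 - 10 * \<kappa> \<le> (a t)^2" by (simp add: power2_eq_square algebra_simps)
qed

lemma b_lower_early:
  assumes "0 \<le> t" "t \<le> T1"
  shows "\<epsilon> * ((1 - 11 * \<kappa>) * t) \<le> b t"
proof -
  have "b 0 + \<epsilon> * (1 - 11 * \<kappa>) * (t - 0) \<le> b t"
  proof (rule derivative_ge_imp_increment_ge[OF assms(1) deriv_b[THEN has_deriv_subset]])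
    fix s assume s: "0 \<le> s" "s \<le> t"
    have "\<epsilon> * (1 - 11 * \<kappa>) \<le> \<epsilon> * ((a s)^2 - exp (- M))"
      using a_early(3)[of s] delta_le_kappa s assms eps_pos by (intro mult_left_mono) auto
    also have "\<dots> \<le> \<epsilon> * (a s)^2 - (1 / \<epsilon>) * M * (c s)^2"
      using deriv_b_lower[of s] s assms T1_bounds by auto
    finally show "\<epsilon> * (1 - 11 * \<kappa>) \<le> \<epsilon> * (a s)^2 - (1 / \<epsilon>) * M * (c s)^2" .
  qed auto
  then show ?thesis by (simp add: init mult.assoc)
qed

lemma b_lower_late:
  assumes "T1 \<le> t" "t \<le> 2"
  shows "\<epsilon> * (T1 - 19 * \<kappa>) \<le> b t"
proof -
  have "\<kappa> * T1 \<le> \<kappa> * (3/2)" by (rule mult_left_mono) (use T1_bounds kappa_pos in auto)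
  moreover have "(1 - 11 * \<kappa>) * T1 = T1 - 11 * (\<kappa> * T1)" by (simp add: algebra_simps)
  ultimately have "T1 - 19 * \<kappa> \<le> (1 - 11 * \<kappa>) * T1 - 2 * exp (- M)"
    using delta_le_kappa kappa_pos by linarith
  then have "\<epsilon> * (T1 - 19 * \<kappa>) \<le> \<epsilon> * ((1 - 11 * \<kappa>) * T1 - 2 * exp (- M))"
    using eps_pos by (intro mult_left_mono) auto
  also have "\<dots> = \<epsilon> * ((1 - 11 * \<kappa>) * T1) - 2 * \<epsilon> * exp (- M)" by (simp add: algebra_simps)
  also have "\<dots> \<le> b t"
    using b_lower_early[of T1] b_lower_from[of T1 t] assms T1_bounds by auto
  finally show ?thesis .
qed

text \<open>Already the time interval \<open>[0, 1/M]\<close> supplies the seed that is amplified until \<^term>\<open>T1\<close>.\<close>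

lemma c_lower_T1: "\<epsilon>^2 * exp (M * (T1^2 / 2 - 1) - 1) / (4 * M) \<le> c T1"
proof -
  define \<mu> where "\<mu> = 1 - 11 * \<kappa>"
  define p where "p s = c s * exp (- (M * \<mu> * s^2 / 2))" for s
  define p' where "p' s = exp (- (M * \<mu> * s^2 / 2)) * (\<epsilon>^2 * exp (- M) * (a s)^2 + M / \<epsilon> * ((b s - \<epsilon> * (\<mu> * s)) * c s))" for s
  have \<mu>: "0 \<le> \<mu>" "\<mu> \<le> 1" using kappa_pos kappa_le by (auto simp: \<mu>_def)
  have invM: "0 \<le> 1 / M" "1 / M \<le> 1" using M_ge by auto
  have D: "(p has_real_derivative p' s) (at s within {l..u})" if "0 \<le> s" "0 \<le> l" for s l u
    unfolding p_def p'_def using eps_pos that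
    by (auto intro!: derivative_eq_intros deriv_within simp: field_simps)
  have lower: "exp (- (M * \<mu> * s^2 / 2)) * (\<epsilon>^2 * exp (- M) * (a s)^2) \<le> p' s"
    if "0 \<le> s" "s \<le> T1" for s
  proof -
    have "0 \<le> (b s - \<epsilon> * (\<mu> * s)) * c s"
      using b_lower_early[OF that] c_nonneg[of s] that by (simp add: \<mu>_def)
    then have "0 \<le> M / \<epsilon> * ((b s - \<epsilon> * (\<mu> * s)) * c s)"
      by (rule mult_nonneg_nonneg[OF M_eps_nonneg])
    then show ?thesis unfolding p'_def by (intro mult_left_mono) auto
  qed
  have "p 0 + (\<epsilon>^2 * exp (- M) / 4) * (1 / M - 0) \<le> p (1 / M)"
  proof (rule derivative_ge_imp_increment_ge[OF invM(1) D])
    fix s assume s: "0 \<le> s" "s \<le> 1 / M"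
    have "M * \<mu> * s^2 \<le> M * 1 * (1 / M)^2"
      using s \<mu> M_ge by (intro mult_mono power_mono) auto
    also have "\<dots> \<le> 1" using M_ge by (simp add: power2_eq_square)
    finally have "exp (- (1/2)) \<le> exp (- (M * \<mu> * s^2 / 2))" by simp
    moreover have "1 + - (1/2) \<le> exp (- (1/2::real))" by (rule exp_ge_add_one_self)
    ultimately have "1/2 \<le> exp (- (M * \<mu> * s^2 / 2))" by linarith
    moreover have "1/2 \<le> (a s)^2"
      using a_early(3)[of s] s invM T1_bounds kappa_le by simp
    ultimately have "1/2 * (\<epsilon>^2 * exp (- M) * (1/2)) \<le> exp (- (M * \<mu> * s^2 / 2)) * (\<epsilon>^2 * exp (- M) * (a s)^2)"
      by (intro mult_mono) auto
    also have "\<dots> \<le> p' s" using lower s invM T1_bounds by simp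
    finally show "\<epsilon>^2 * exp (- M) / 4 \<le> p' s" by simp
  qed auto
  also have "p (1 / M) \<le> p T1"
  proof (rule derivative_nonneg_imp_le[OF _ D])
    fix s assume "1 / M \<le> s" "s \<le> T1"
    with lower[of s] invM show "0 \<le> p' s" by (smt (verit) exp_ge_zero mult_nonneg_nonneg zero_le_power2)
  qed (use invM T1_bounds in linarith)+
  finally have "\<epsilon>^2 * exp (- M) / (4 * M) \<le> c T1 * exp (- (M * \<mu> * T1^2 / 2))"
    by (simp add: p_def init)
  then have "\<epsilon>^2 * exp (- M) / (4 * M) * exp (M * \<mu> * T1^2 / 2)
    \<le> c T1 * exp (- (M * \<mu> * T1^2 / 2)) * exp (M * \<mu> * T1^2 / 2)"
    by (intro mult_right_mono) auto
  also have "\<dots> = c T1" by (simp add: mult.assoc flip: exp_add)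
  also have "\<epsilon>^2 * exp (- M) / (4 * M) * exp (M * \<mu> * T1^2 / 2)
    = \<epsilon>^2 * (exp (- M) * exp (M * \<mu> * T1^2 / 2)) / (4 * M)"
    by (simp only: times_divide_eq_left mult.assoc)
  also have "exp (- M) * exp (M * \<mu> * T1^2 / 2) = exp (M * \<mu> * T1^2 / 2 - M)"
    by (simp flip: exp_add)
  finally have *: "\<epsilon>^2 * exp (M * \<mu> * T1^2 / 2 - M) / (4 * M) \<le> c T1" .
  have "T1^2 \<le> (3/2)^2" using T1_bounds by (intro power_mono) auto
  then have "M * \<kappa> * T1^2 \<le> M * \<kappa> * (9/4)"
    using M_ge kappa_pos by (intro mult_left_mono) (auto simp: power2_eq_square)
  then have "M * (T1^2 / 2 - 1) - 1 \<le> M * \<mu> * T1^2 / 2 - M"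
    using M_kappa by (simp add: \<mu>_def algebra_simps)
  then have "\<epsilon>^2 * exp (M * (T1^2 / 2 - 1) - 1) / (4 * M) \<le> \<epsilon>^2 * exp (M * \<mu> * T1^2 / 2 - M) / (4 * M)"
    using M_ge by (intro divide_right_mono mult_left_mono) auto
  with * show ?thesis by simp
qed

definition T2 where "T2 = T1 + 3/2 * r"

lemma T2_bounds: "T1 \<le> T2" "T2 + r / 2 \<le> 2"
  using sqrt2_bounds r_pos r_le by (auto simp: T2_def T1_def)

lemma c_lower_T2: "\<epsilon>^2 * (exp (M * r / 2 - 3) / (4 * M)) \<le> c T2"
proof -
  define \<nu> where "\<nu> = M * (T1 - 19 * \<kappa>)"
  define p where "p s = c s * exp (- (\<nu> * s))" for s
  have "p T1 \<le> p T2"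
  proof (rule derivative_nonneg_imp_le[OF T2_bounds(1)])
    fix s assume s: "T1 \<le> s" "s \<le> T2"
    show "(p has_real_derivative
      exp (- (\<nu> * s)) * (\<epsilon>^2 * exp (- M) * (a s)^2 + M / \<epsilon> * ((b s - \<epsilon> * (T1 - 19 * \<kappa>)) * c s)))
        (at s within {T1..T2})"
      unfolding p_def \<nu>_def using eps_pos s T1_bounds
      by (auto intro!: derivative_eq_intros deriv_within simp: field_simps)
    have "0 \<le> (b s - \<epsilon> * (T1 - 19 * \<kappa>)) * c s"
      using b_lower_late[of s] c_nonneg[of s] s T1_bounds T2_bounds r_pos by simp
    then have "0 \<le> M / \<epsilon> * ((b s - \<epsilon> * (T1 - 19 * \<kappa>)) * c s)"
      by (rule mult_nonneg_nonneg[OF M_eps_nonneg])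
    then show "0 \<le> exp (- (\<nu> * s)) *
      (\<epsilon>^2 * exp (- M) * (a s)^2 + M / \<epsilon> * ((b s - \<epsilon> * (T1 - 19 * \<kappa>)) * c s))" by simp
  qed
  then have "p T1 * exp (\<nu> * T2) \<le> p T2 * exp (\<nu> * T2)" by (intro mult_right_mono) auto
  then have *: "c T1 * exp (\<nu> * (T2 - T1)) \<le> c T2"
    by (simp add: p_def mult.assoc algebra_simps flip: exp_add)
  have "r^2 \<le> r * (1/5)" unfolding power2_eq_square using r_pos r_le by (intro mult_left_mono) auto
  moreover have "141/100 * r \<le> sqrt 2 * r" using sqrt2_bounds r_pos by (intro mult_right_mono) auto
  moreover have "T1 * (3/2 * r) = 3/2 * (sqrt 2 * r) - 3/2 * r^2"
    by (simp add: T1_def field_simps power2_eq_square)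
  ultimately have "r / 2 \<le> (T1^2 / 2 - 1) + T1 * (3/2 * r)"
    unfolding T1_sq using r_pos by linarith
  then have "M * (r / 2) \<le> M * ((T1^2 / 2 - 1) + T1 * (3/2 * r))"
    using M_ge by (intro mult_left_mono) auto
  moreover have "M * \<kappa> * r \<le> M * \<kappa> * (1/5)" using r_le M_ge kappa_pos by (intro mult_left_mono) auto
  ultimately have "M * r / 2 - 3 \<le> (M * (T1^2 / 2 - 1) - 1) + \<nu> * (T2 - T1)"
    using M_kappa by (simp add: T2_def \<nu>_def algebra_simps)
  then have "\<epsilon>^2 * (exp (M * r / 2 - 3) / (4 * M))
      \<le> \<epsilon>^2 * (exp ((M * (T1^2 / 2 - 1) - 1) + \<nu> * (T2 - T1)) / (4 * M))"
    using M_ge by (intro mult_left_mono divide_right_mono) auto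
  also have "\<dots> = \<epsilon>^2 * exp (M * (T1^2 / 2 - 1) - 1) / (4 * M) * exp (\<nu> * (T2 - T1))"
    by (simp add: exp_add)
  also have "\<dots> \<le> c T1 * exp (\<nu> * (T2 - T1))"
    using c_lower_T1 by (intro mult_right_mono) auto
  also note *
  finally show ?thesis .
qed

lemma c_lower_late:
  assumes "T2 \<le> t" "t \<le> 2"
  shows "\<epsilon>^2 * (exp (M * r / 2 - 3) / (4 * M)) \<le> c t"
proof -
  have "c T2 \<le> c t"
  proof (rule derivative_nonneg_imp_le[OF assms(1) deriv_c[THEN has_deriv_subset]])
    fix s assume s: "T2 \<le> s" "s \<le> t"
    have "0 \<le> T1 - 19 * \<kappa>" using T1_bounds kappa_le by simp
    then have "0 \<le> \<epsilon> * (T1 - 19 * \<kappa>)" using eps_pos by simp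
    also have "\<dots> \<le> b s" using b_lower_late[of s] s assms T2_bounds by simp
    finally have "0 \<le> b s" .
    then show "0 \<le> \<epsilon>^2 * exp (- M) * (a s)^2 + (1 / \<epsilon>) * M * b s * c s"
      using eps_pos M_ge c_nonneg[of s] s T1_bounds T2_bounds by simp
  qed (use T1_bounds T2_bounds in auto)
  with c_lower_T2 show ?thesis by simp
qed

definition w where "w t = \<epsilon>^2 / c t"

text \<open>Once \<open>1 / w\<close> is large, \<^term>\<open>a\<close> and \<^term>\<open>d\<close> rotate into each other so quickly that
  \<open>a^2\<close> and \<open>d^2\<close> agree on average: up to an error of order \<^term>\<open>w\<close> their difference is
  the derivative of \<open>a * d * w\<close>. Adding a multiple of this small quantity to \<^term>\<open>z\<close> therefore
  turns \<open>K * d^2\<close> into \<open>K / 2 * (a^2 + d^2)\<close>.\<close>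

lemma z_at_end:
  assumes "K \<le> M" "exp (- M) \<le> \<theta>" "M * \<theta> \<le> 1" "4 * M * exp (3 - M * r / 2) \<le> \<theta>"
  shows "1 - z (sqrt 2 + r) \<le> 2 * exp (- (K * r / 4)) + 8 * (M * \<theta>)"
proof -
  define T3 where "T3 = sqrt 2 + r"
  have T3: "T3 = T2 + r / 2" by (simp add: T3_def T2_def T1_def)
  have T23: "0 \<le> T2" "T2 \<le> T3" "T3 \<le> 2" using T1_bounds T2_bounds r_pos by (auto simp: T3)
  have \<theta>: "0 < \<theta>" using assms(2) exp_gt_zero[of "- M"] by linarith
  have "1 * \<theta> \<le> M * \<theta>" using \<theta> M_ge by (intro mult_right_mono) auto
  then have \<theta>1: "\<theta> \<le> 1" using assms(3) by simp
  have K\<theta>: "K * \<theta> \<le> M * \<theta>" using \<theta> assms(1) by (intro mult_right_mono) auto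
  have c_pos: "0 < c t" and w: "0 < w t" "w t \<le> \<theta>" if "T2 \<le> t" "t \<le> T3" for t
  proof -
    define X where "X = exp (M * r / 2 - 3) / (4 * M)"
    have X: "0 < X" using M_ge by (simp add: X_def)
    have cX: "\<epsilon>^2 * X \<le> c t" using c_lower_late[of t] that T23 by (simp add: X_def)
    have "0 < \<epsilon>^2 * X" using X eps_pos by simp
    with cX show c: "0 < c t" by linarith
    then show "0 < w t" using eps_pos by (simp add: w_def)
    have "w t \<le> 1 / X" using cX c X by (simp add: w_def field_simps)
    also have "\<dots> = 4 * M * exp (3 - M * r / 2)"
      by (simp add: X_def exp_diff)
    finally show "w t \<le> \<theta>" using assms(4) by simp
  qed
  define e where "e t = \<epsilon> * a t * b t + \<epsilon>^2 * exp (- M) * a t * c t" for t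
  define R where "R t = (e t * d t + K * (a t * d t * z t)
    + a t * d t * (exp (- M) * (a t)^2 * w t + M * (b t / \<epsilon>))) * w t" for t
  define g where "g t = z t + K / 2 * (a t * d t * w t)" for t
  define g' where "g' t = K / 2 * ((a t)^2 + (d t)^2 - R t)" for t
  have D: "(g has_real_derivative g' t) (at t within {T2..T3})" if t: "T2 \<le> t" "t \<le> T3" for t
  proof -
    have "(g has_real_derivative (K * (d t)^2 + K / 2 *
        (((- (1 / \<epsilon>^2) * c t * d t - \<epsilon> * a t * b t - \<epsilon>^2 * exp (- M) * a t * c t) * d t
          + a t * ((1 / \<epsilon>^2) * c t * a t - K * d t * z t)) * w t
        + a t * d t * (- (\<epsilon>^2) * (\<epsilon>^2 * exp (- M) * (a t)^2 + (1 / \<epsilon>) * M * b t * c t) / (c t)^2))))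
        (at t within {T2..T3})"
      unfolding g_def w_def using t T23 c_pos[OF t]
      by (auto intro!: derivative_eq_intros deriv_within) (simp add: field_simps power2_eq_square)
    moreover have "K * (d t)^2 + K / 2 *
        (((- (1 / \<epsilon>^2) * c t * d t - \<epsilon> * a t * b t - \<epsilon>^2 * exp (- M) * a t * c t) * d t
          + a t * ((1 / \<epsilon>^2) * c t * a t - K * d t * z t)) * w t
        + a t * d t * (- (\<epsilon>^2) * (\<epsilon>^2 * exp (- M) * (a t)^2 + (1 / \<epsilon>) * M * b t * c t) / (c t)^2)) = g' t"
      unfolding g'_def R_def e_def w_def using c_pos[OF t] eps_pos
      by (simp add: field_simps power2_eq_square)
    ultimately show ?thesis by simp
  qed
  have adw: "\<bar>a t * d t * w t\<bar> \<le> \<theta>" if "T2 \<le> t" "t \<le> T3" for t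
  proof -
    have "\<bar>a t * d t * w t\<bar> \<le> 1 * 1 * \<theta>"
      unfolding abs_mult using abs_le_1[of t] w[OF that] that T23 by (intro mult_mono) auto
    then show ?thesis by simp
  qed
  have Kadw: "\<bar>K / 2 * (a t * d t * w t)\<bar> \<le> M * \<theta> / 2" if "T2 \<le> t" "t \<le> T3" for t
  proof -
    have "K / 2 * \<bar>a t * d t * w t\<bar> \<le> K / 2 * \<theta>"
      using adw[OF that] K_ge by (intro mult_left_mono) auto
    moreover have "\<bar>K / 2 * (a t * d t * w t)\<bar> = K / 2 * \<bar>a t * d t * w t\<bar>"
      using K_ge by (simp add: abs_mult)
    ultimately show ?thesis using K\<theta> by linarith
  qed
  have R: "\<bar>R t\<bar> \<le> 5 * (M * \<theta>)" if "T2 \<le> t" "t \<le> T3" for t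
  proof -
    have t: "0 \<le> t" "t \<le> 2" using that T23 by auto
    note A = abs_le_1[OF t(1)]
    have "\<bar>e t * d t\<bar> \<le> 1 * 1"
      unfolding abs_mult using A drift_small[OF t] delta_le by (intro mult_mono) (auto simp: e_def)
    moreover have "\<bar>K * (a t * d t * z t)\<bar> \<le> K * (1 * 1 * 1)"
      unfolding abs_mult using A K_ge by (intro mult_mono) auto
    moreover have "\<bar>exp (- M) * (a t)^2 * w t\<bar> \<le> 1 * 1 * 1"
      unfolding abs_mult using a_sq_le[OF t(1)] w[OF that] \<theta>1 M_ge by (intro mult_mono) auto
    moreover have "\<bar>M * (b t / \<epsilon>)\<bar> \<le> M * 2"
    proof -
      have "\<bar>b t / \<epsilon>\<bar> \<le> 2" using abs_b_le[OF t] eps_pos by (simp add: field_simps)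
      then have "M * \<bar>b t / \<epsilon>\<bar> \<le> M * 2" using M_ge by (intro mult_left_mono) auto
      then show ?thesis using M_ge by (simp add: abs_mult)
    qed
    ultimately have B: "\<bar>exp (- M) * (a t)^2 * w t + M * (b t / \<epsilon>)\<bar> \<le> 1 + 2 * M"
      and C: "\<bar>e t * d t\<bar> \<le> 1" "\<bar>K * (a t * d t * z t)\<bar> \<le> K" by linarith+
    have sum3: "\<bar>x + y + v\<bar> \<le> 5 * M" if "\<bar>x\<bar> \<le> 1" "\<bar>y\<bar> \<le> K" "\<bar>v\<bar> \<le> 1 * 1 * (1 + 2 * M)" for x y v
      using that assms(1) M_ge by simp
    have "\<bar>a t * d t * (exp (- M) * (a t)^2 * w t + M * (b t / \<epsilon>))\<bar> \<le> 1 * 1 * (1 + 2 * M)"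
      unfolding abs_mult[of "a t * d t"] abs_mult[of "a t"]
      using A B by (intro mult_mono) auto
    then have "\<bar>e t * d t + K * (a t * d t * z t)
      + a t * d t * (exp (- M) * (a t)^2 * w t + M * (b t / \<epsilon>))\<bar> \<le> 5 * M"
      by (rule sum3[OF C])
    then have "\<bar>e t * d t + K * (a t * d t * z t)
      + a t * d t * (exp (- M) * (a t)^2 * w t + M * (b t / \<epsilon>))\<bar> * \<bar>w t\<bar> \<le> 5 * M * \<theta>"
      using w[OF that] by (intro mult_mono) auto
    then show ?thesis by (simp add: R_def abs_mult)
  qed
  have g'_lower: "K / 2 * (1 - g t - 7 * (M * \<theta>)) \<le> g' t" if "T2 \<le> t" "t \<le> T3" for t
  proof -
    have t: "0 \<le> t" "t \<le> 2" using that T23 by auto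
    have e1: "\<epsilon> \<le> 1" using eps_le_delta delta_le by linarith
    have "(b t)^2 \<le> (2 * \<epsilon>)^2"
      using abs_b_le[OF t] power_mono[of "\<bar>b t\<bar>" "2 * \<epsilon>" 2] by simp
    moreover have "(c t)^2 \<le> \<epsilon>^2"
      using c_le_eps(2)[OF t] c_nonneg[OF t(1)] by (intro power_mono) auto
    moreover have "\<epsilon>^2 \<le> \<epsilon> * 1" unfolding power2_eq_square using e1 eps_pos by (intro mult_left_mono) auto
    moreover have "(z t)^2 \<le> z t * 1" unfolding power2_eq_square
      using z_nonneg[OF t(1)] abs_le_1(5)[OF t(1)] by (intro mult_left_mono) auto
    ultimately have "1 - z t - \<theta> \<le> (a t)^2 + (d t)^2"
      using energy[OF t(1)] eps_le_delta assms(2) eps_pos by (simp add: power_mult_distrib)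
    moreover have "\<theta> \<le> M * \<theta>" using \<open>1 * \<theta> \<le> M * \<theta>\<close> by simp
    moreover note Kadw[OF that] R[OF that]
    ultimately have "1 - g t - 7 * (M * \<theta>) \<le> (a t)^2 + (d t)^2 - R t"
      using \<theta> unfolding g_def by linarith
    then show ?thesis unfolding g'_def using K_ge by (intro mult_left_mono) auto
  qed
  define q where "q t = 1 - g t - 7 * (M * \<theta>)" for t
  have "q T3 * exp (K / 2 * T3) \<le> q T2 * exp (K / 2 * T2) + 0 * (T3 - T2)"
  proof (rule derivative_le_imp_increment_le[OF T23(2)])
    fix t assume t: "T2 \<le> t" "t \<le> T3"
    show "((\<lambda>t. q t * exp (K / 2 * t)) has_real_derivative
      (K / 2 * q t - g' t) * exp (K / 2 * t)) (at t within {T2..T3})"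
      unfolding q_def by (auto intro!: derivative_eq_intros D t simp: algebra_simps)
    show "(K / 2 * q t - g' t) * exp (K / 2 * t) \<le> 0"
      using g'_lower[OF t] by (intro mult_nonpos_nonneg) (auto simp: q_def)
  qed
  then have "q T3 * exp (K / 2 * T3) * exp (- (K / 2 * T3)) \<le> q T2 * exp (K / 2 * T2) * exp (- (K / 2 * T3))"
    by (intro mult_right_mono) auto
  then have "q T3 \<le> q T2 * exp (K / 2 * T2 - K / 2 * T3)"
    by (simp add: mult.assoc flip: exp_add)
  also have "K / 2 * T2 - K / 2 * T3 = - (K * r / 4)" by (simp add: T3 field_simps)
  also have "q T2 * exp (- (K * r / 4)) \<le> 2 * exp (- (K * r / 4))"
  proof (rule mult_right_mono)
    show "q T2 \<le> 2"
      using Kadw[of T2] T23 z_nonneg[of T2] \<theta> M_ge assms(3) by (simp add: q_def g_def)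
  qed auto
  finally show ?thesis
    using Kadw[of T3] T23 \<theta> M_ge by (simp add: q_def g_def T3_def)
qed

lemma bounds_before_transition:
  assumes "0 < \<eta>" "\<eta> \<le> 1" "10 * \<kappa> \<le> \<eta>^2" "0 \<le> t" "t \<le> sqrt 2 - r"
  shows "\<bar>a t - 1\<bar> \<le> \<eta>" "\<bar>b t\<bar> \<le> \<eta>" "\<bar>c t\<bar> \<le> \<eta>" "\<bar>d t\<bar> \<le> \<eta>" "\<bar>z t\<bar> \<le> \<eta>"
proof -
  have "\<eta>^2 \<le> \<eta> * 1" unfolding power2_eq_square using assms by (intro mult_left_mono) auto
  moreover note a_early[of t]
  ultimately show "\<bar>a t - 1\<bar> \<le> \<eta>" using assms kappa_pos by (simp add: T1_def)
  have "(b t)^2 + (c t)^2 + (d t)^2 + (z t)^2 \<le> \<eta>^2"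
    using a_early(3)[of t] energy[of t] assms by (simp add: T1_def)
  then have "(b t)^2 \<le> \<eta>^2" "(c t)^2 \<le> \<eta>^2" "(d t)^2 \<le> \<eta>^2" "(z t)^2 \<le> \<eta>^2"
    by (smt (verit) zero_le_power2)+
  then show "\<bar>b t\<bar> \<le> \<eta>" "\<bar>c t\<bar> \<le> \<eta>" "\<bar>d t\<bar> \<le> \<eta>" "\<bar>z t\<bar> \<le> \<eta>"
    using assms(1) by (auto simp: power2_le_iff_abs_le)
qed

lemma bounds_after_transition:
  assumes "0 < \<eta>" "\<eta> \<le> 1" "1 - z (sqrt 2 + r) \<le> \<eta>^2 / 2" "sqrt 2 + r \<le> t"
  shows "\<bar>z t - 1\<bar> \<le> \<eta>" "\<bar>a t\<bar> \<le> \<eta>" "\<bar>b t\<bar> \<le> \<eta>" "\<bar>c t\<bar> \<le> \<eta>" "\<bar>d t\<bar> \<le> \<eta>"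
proof -
  have t0: "0 \<le> sqrt 2 + r" "0 \<le> t" using r_pos sqrt2_bounds assms by auto
  have z: "1 - \<eta>^2 / 2 \<le> z t" "z t \<le> 1"
    using z_mono[OF t0(1) assms(4)] assms(3) abs_le_1(5)[OF t0(2)] by auto
  have "\<eta>^2 \<le> \<eta> * 1" unfolding power2_eq_square using assms by (intro mult_left_mono) auto
  then show "\<bar>z t - 1\<bar> \<le> \<eta>" using z assms(1) by simp
  have "(1 - z t) * (1 + z t) \<le> (\<eta>^2 / 2) * 2"
    using z z_nonneg[OF t0(2)] by (intro mult_mono) auto
  then have "1 - (z t)^2 \<le> \<eta>^2" by (simp add: power2_eq_square algebra_simps)
  then have "(a t)^2 + (b t)^2 + (c t)^2 + (d t)^2 \<le> \<eta>^2"
    using energy[OF t0(2)] by linarith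
  then have "(a t)^2 \<le> \<eta>^2" "(b t)^2 \<le> \<eta>^2" "(c t)^2 \<le> \<eta>^2" "(d t)^2 \<le> \<eta>^2"
    by (smt (verit) zero_le_power2)+
  then show "\<bar>a t\<bar> \<le> \<eta>" "\<bar>b t\<bar> \<le> \<eta>" "\<bar>c t\<bar> \<le> \<eta>" "\<bar>d t\<bar> \<le> \<eta>"
    using assms(1) by (auto simp: power2_le_iff_abs_le)
qed

end

lemma eventually_parameters:
  "\<forall>\<^sub>F K::real in at_top. 1 \<le> K \<and> K \<le> K^10 \<and> 1 / sqrt K \<le> 1/5 \<and>
    27 * K^10 * exp (- (K^10 * (1 / sqrt K))) \<le> 1 \<and>
    exp (- (K^10)) \<le> 1 / K^40 \<and>
    K^10 * (1 / K^40) \<le> 1 \<and>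
    4 * K^10 * exp (3 - K^10 * (1 / sqrt K) / 2) \<le> 1 / K^40 \<and>
    10 * exp (- (K^10 * (1 / sqrt K))) \<le> 1 / K^20 \<and>
    2 * exp (- (K * (1 / sqrt K) / 4)) + 8 * (K^10 * (1 / K^40)) \<le> 1 / K^20 / 2"
  by (intro eventually_conj; real_asymp)

theorem theorem5p3:
  "\<exists>K\<^sub>0 A :: real. K\<^sub>0 \<ge> 1 \<and> A > 0 \<and>
    (\<forall>K\<ge>K\<^sub>0. \<exists>\<epsilon>\<^sub>0>0. \<forall>\<epsilon>. 0 < \<epsilon> \<and> \<epsilon> \<le> \<epsilon>\<^sub>0 \<longrightarrow>
      (\<forall>a b c d a'.
        solves_ode K \<epsilon> a b c d a' \<and>
        a 0 = 1 \<and> b 0 = 0 \<and> c 0 = 0 \<and> d 0 = 0 \<and> a' 0 = 0 \<longrightarrow>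
        (\<exists>t\<^sub>c. \<bar>t\<^sub>c - sqrt 2\<bar> \<le> A / sqrt K \<and>
          (\<forall>t. 0 \<le> t \<and> t \<le> t\<^sub>c - 1 / sqrt K \<longrightarrow>
             \<bar>a t - 1\<bar> \<le> A / K^10 \<and> \<bar>b t\<bar> \<le> A / K^10 \<and> \<bar>c t\<bar> \<le> A / K^10 \<and>
             \<bar>d t\<bar> \<le> A / K^10 \<and> \<bar>a' t\<bar> \<le> A / K^10) \<and>
          (\<forall>t. 0 \<le> t \<and> t \<ge> t\<^sub>c + 1 / sqrt K \<longrightarrow>
             \<bar>a' t - 1\<bar> \<le> A / K^10 \<and> \<bar>a t\<bar> \<le> A / K^10 \<and> \<bar>b t\<bar> \<le> A / K^10 \<and>
             \<bar>c t\<bar> \<le> A / K^10 \<and> \<bar>d t\<bar> \<le> A / K^10))))"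
proof -
  obtain K\<^sub>0 :: real where K\<^sub>0: "\<And>K. K\<^sub>0 \<le> K \<Longrightarrow> 1 \<le> K \<and> K \<le> K^10 \<and> 1 / sqrt K \<le> 1/5 \<and>
    27 * K^10 * exp (- (K^10 * (1 / sqrt K))) \<le> 1 \<and>
    exp (- (K^10)) \<le> 1 / K^40 \<and>
    K^10 * (1 / K^40) \<le> 1 \<and>
    4 * K^10 * exp (3 - K^10 * (1 / sqrt K) / 2) \<le> 1 / K^40 \<and>
    10 * exp (- (K^10 * (1 / sqrt K))) \<le> 1 / K^20 \<and>
    2 * exp (- (K * (1 / sqrt K) / 4)) + 8 * (K^10 * (1 / K^40)) \<le> 1 / K^20 / 2"
    using eventually_parameters unfolding eventually_at_top_linorder by blast
  have "1 \<le> K\<^sub>0" using K\<^sub>0[of K\<^sub>0] by blast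
  have main: "(\<forall>t. 0 \<le> t \<and> t \<le> sqrt 2 - 1 / sqrt K \<longrightarrow>
             \<bar>a t - 1\<bar> \<le> 1 / K^10 \<and> \<bar>b t\<bar> \<le> 1 / K^10 \<and> \<bar>c t\<bar> \<le> 1 / K^10 \<and>
             \<bar>d t\<bar> \<le> 1 / K^10 \<and> \<bar>a' t\<bar> \<le> 1 / K^10) \<and>
          (\<forall>t. 0 \<le> t \<and> t \<ge> sqrt 2 + 1 / sqrt K \<longrightarrow>
             \<bar>a' t - 1\<bar> \<le> 1 / K^10 \<and> \<bar>a t\<bar> \<le> 1 / K^10 \<and> \<bar>b t\<bar> \<le> 1 / K^10 \<and>
             \<bar>c t\<bar> \<le> 1 / K^10 \<and> \<bar>d t\<bar> \<le> 1 / K^10)"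
    if K: "K\<^sub>0 \<le> K" and \<epsilon>: "0 < \<epsilon>" "\<epsilon> \<le> exp (- 2 * K^10)"
      and ode: "solves_ode K \<epsilon> a b c d a'" "a 0 = 1" "b 0 = 0" "c 0 = 0" "d 0 = 0" "a' 0 = 0"
    for K \<epsilon> and a b c d a' :: "real \<Rightarrow> real"
  proof -
    note P = K\<^sub>0[OF K]
    interpret circuit K "K^10" "1 / sqrt K" \<epsilon> a b c d a'
      using P \<epsilon> ode by unfold_locales (auto simp: solves_ode_def)
    have \<eta>: "0 < 1 / K^10" "1 / K^10 \<le> 1" "(1 / K^10)^2 = 1 / K^20"
      using P by (auto simp: power_divide simp flip: power_mult)
    have 1: "10 * \<kappa> \<le> (1 / K^10)^2" using P by (simp only: \<eta>(3) \<kappa>_def)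
    have 2: "1 - a' (sqrt 2 + 1 / sqrt K) \<le> (1 / K^10)^2 / 2"
      unfolding \<eta>(3) by (rule order_trans[OF z_at_end[of "1 / K^40"]]) (use P in blast)+
    show ?thesis using bounds_before_transition[OF \<eta>(1,2) 1] bounds_after_transition[OF \<eta>(1,2) 2] by blast
  qed
  show ?thesis
  proof (rule exI[of _ K\<^sub>0], rule exI[of _ 1], intro conjI allI impI)
    fix K assume K: "K\<^sub>0 \<le> K"
    have "1 \<le> K" using K \<open>1 \<le> K\<^sub>0\<close> by simp
    show "\<exists>\<epsilon>\<^sub>0>0. \<forall>\<epsilon>. 0 < \<epsilon> \<and> \<epsilon> \<le> \<epsilon>\<^sub>0 \<longrightarrow>
      (\<forall>a b c d a'.
        solves_ode K \<epsilon> a b c d a' \<and>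
        a 0 = 1 \<and> b 0 = 0 \<and> c 0 = 0 \<and> d 0 = 0 \<and> a' 0 = 0 \<longrightarrow>
        (\<exists>t\<^sub>c. \<bar>t\<^sub>c - sqrt 2\<bar> \<le> 1 / sqrt K \<and>
          (\<forall>t. 0 \<le> t \<and> t \<le> t\<^sub>c - 1 / sqrt K \<longrightarrow>
             \<bar>a t - 1\<bar> \<le> 1 / K^10 \<and> \<bar>b t\<bar> \<le> 1 / K^10 \<and> \<bar>c t\<bar> \<le> 1 / K^10 \<and>
             \<bar>d t\<bar> \<le> 1 / K^10 \<and> \<bar>a' t\<bar> \<le> 1 / K^10) \<and>
          (\<forall>t. 0 \<le> t \<and> t \<ge> t\<^sub>c + 1 / sqrt K \<longrightarrow>
             \<bar>a' t - 1\<bar> \<le> 1 / K^10 \<and> \<bar>a t\<bar> \<le> 1 / K^10 \<and> \<bar>b t\<bar> \<le> 1 / K^10 \<and>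
             \<bar>c t\<bar> \<le> 1 / K^10 \<and> \<bar>d t\<bar> \<le> 1 / K^10)))"
      by (rule exI[of _ "exp (- 2 * K^10)"], intro conjI allI impI exI[of _ "sqrt 2"])
        (use main[OF K] \<open>1 \<le> K\<close> in auto)
  qed (use \<open>1 \<le> K\<^sub>0\<close> in auto)
qed

end
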